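(* If $m>1$, then Su+ uniformly improves Su.
   Context: Setting: a statistical model $M$ is a set of probability measures and $H_1,\dots,H_m\subseteq M$ are hypotheses; for $\mathrm{P}\in M$, $N_{\mathrm{P}}=\{i:\mathrm{P}\in H_i\}$ is the index set of true hypotheses. Random quantities are in boldface. $\mathbf{p}_1\le\dots\le\mathbf{p}_m$ are $p$-values for $H_1,\dots,H_m$, assumed ordered without loss of generality. They are assumed to satisfy PRDN in $M$: for every $\mathrm{P}\in M$, every increasing set $A\subseteq\mathbb{R}^{|N_{\mathrm{P}}|}$ and every $i\in N_{\mathrm{P}}$, $\mathrm{P}((\mathbf{p}_j)_{j\in N_{\mathrm{P}}}\in A\mid\mathbf{p}_i=t)$ is weakly increasing in $t$. Notation: $[m]=\{1,\dots,m\}$, $[0]=\emptyset$, $2^{[m]}$ is the power set of $[m]$, $\mathcal{M}=2^{[m]}\setminus\{\emptyset\}$, $a\vee b=\max(a,b)$. The level $\alpha\in(0,1]$ is fixed. Let $w$ be the $-1$ branch of the Lambert W function, $e=\exp(1)$, and $l_\alpha=-1/w(-\alpha/e)$; equivalently, $q=\alpha l_\alpha$ solves $\alpha=q-q\log q$. FDR control at level $\alpha$: a random set $\mathbf{R}\subseteq[m]$ controls FDR at level $\alpha$ if $\mathrm{E}_{\mathrm{P}}\big(|\mathbf{R}\cap N_{\mathrm{P}}|/(|\mathbf{R}|\vee1)\big)\le\alpha$ for every $\mathrm{P}\in M$; a random collection $\boldsymbol{\mathcal{R}}\subseteq2^{[m]}$ controls FDR at level $\alpha$ if $\mathrm{E}_{\mathrm{P}}\big(\max_{R\in\boldsymbol{\mathcal{R}}}|R\cap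 N_{\mathrm{P}}|/(|R|\vee1)\big)\le\alpha$ for every $\mathrm{P}\in M$. Under PRDN, both procedures below control FDR at level $\alpha$. Su (at level $\alpha$) rejects the set $\mathbf{R}_\alpha=[\mathbf{r}_\alpha]$, where $\mathbf{r}_\alpha=\max\{1\le r\le m:\ m\mathbf{p}_r\le r\,\alpha\,l_\alpha\}$, or $\mathbf{r}_\alpha=0$ if the maximum does not exist. Su+ (at level $\alpha$): for $S\in\mathcal{M}$ let $\mathbf{p}_{i:S}$ be the $i$th smallest $p$-value among $(\mathbf{p}_j)_{j\in S}$, let $\mathbf{p}_S=\min_{1\le i\le|S|}|S|\,\mathbf{p}_{i:S}/i$ and $\mathbf{e}_S=\min(l_\alpha/\mathbf{p}_S,\,1/\alpha)$ (read as $1/\alpha$ if $\mathbf{p}_S=0$). Su+ rejects the collection $$\Big\{R\in2^{[m]}:\ \alpha\mathbf{e}_S\ge\frac{|R\cap S|}{|R|\vee1}\ \text{ for all }S\in\mathcal{M}\Big\}.$$ Uniform improvement: let a random collection $\boldsymbol{\mathcal{R}}$ and a random set $\mathbf{S}$ both control FDR at level $\alpha$. Then $\boldsymbol{\mathcal{R}}$ uniformly improves $\mathbf{S}$ if (1) $\mathbf{S}\in\boldsymbol{\mathcal{R}}$ (surely); and (2) there exists an event $E$ such that, if $E$ happens, $\mathbf{S}\subset\mathbf{R}\in\boldsymbol{\mathcal{R}}$ for some $\mathbf{R}$, with $\subset$ denoting strict inclusion.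
   Formalization: The event E is a non-empty set of possible p-value vectors, not outcomes of one particular model; level α = 1 with p-values confined to [0,1] is excluded, since there Su always rejects all m hypotheses and cannot be strictly improved (α = 1 is kept if p-values may exceed 1). *)

theory Defs
  imports "HOL-Probability.Probability"
begin

text \<open>
  Vectors of p-values are extensional functions on \<open>{1..m}\<close>.  \<open>V\<close> is the set of values that a
  single p-value can take: p-values need only be stochastically larger than uniform, so besides
  \<open>{0..1}\<close> also \<open>{0..}\<close> makes sense.  The distinction matters only at level \<open>\<alpha> = 1\<close>: there
  \<open>l_const 1 = 1\<close>, and \<open>su_set\<close> below rejects everything as soon as all p-values are at most 1, so
  that it can be improved only where some p-value exceeds 1.
\<close>

definition pval_space :: "nat \<Rightarrow> real set \<Rightarrow> (nat \<Rightarrow> real) measure" where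
  "pval_space m V = (\<Pi>\<^sub>M i\<in>{1..m}. restrict_space borel V)"


text \<open>Only the measurable structure of \<open>\<Omega>\<close> is used; \<open>M\<close> is the set of probability measures.\<close>

definition statistical_model :: "'a measure \<Rightarrow> 'a measure set \<Rightarrow> bool" where
  "statistical_model \<Omega> M \<longleftrightarrow> (\<forall>P\<in>M. prob_space P \<and> sets P = sets \<Omega>)"

definition true_hyps :: "nat \<Rightarrow> (nat \<Rightarrow> 'a measure set) \<Rightarrow> 'a measure \<Rightarrow> nat set" where
  "true_hyps m H P = {i \<in> {1..m}. P \<in> H i}"

definition valid_pvalues ::
  "'a measure set \<Rightarrow> ('a measure \<Rightarrow> nat set) \<Rightarrow> ('a \<Rightarrow> nat \<Rightarrow> real) \<Rightarrow> bool" where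
  "valid_pvalues M N p \<longleftrightarrow>
     (\<forall>P\<in>M. \<forall>i\<in>N P. \<forall>t\<in>{0..1}. measure P {\<omega> \<in> space P. p \<omega> i \<le> t} \<le> t)"

definition increasing_set :: "nat set \<Rightarrow> (nat \<Rightarrow> real) set \<Rightarrow> bool" where
  "increasing_set I A \<longleftrightarrow> A \<subseteq> (\<Pi>\<^sub>E i\<in>I. UNIV) \<and>
     (\<forall>x\<in>A. \<forall>y\<in>(\<Pi>\<^sub>E i\<in>I. UNIV). (\<forall>i\<in>I. x i \<le> y i) \<longrightarrow> y \<in> A)"

text \<open>
  Conditional probabilities given \<open>p\<^sub>i = t\<close> are determined only up to null sets, so monotonicity in
  \<open>t\<close> means that some version \<open>g\<close> is monotone.  Increasing sets are taken to be Borel, so that the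
  probability is defined.
\<close>

definition PRDN ::
  "'a measure set \<Rightarrow> ('a measure \<Rightarrow> nat set) \<Rightarrow> ('a \<Rightarrow> nat \<Rightarrow> real) \<Rightarrow> bool" where
  "PRDN M N p \<longleftrightarrow>
     (\<forall>P\<in>M. \<forall>A\<in>sets (\<Pi>\<^sub>M j\<in>N P. borel). \<forall>i\<in>N P. increasing_set (N P) A \<longrightarrow>
        (\<exists>g::real \<Rightarrow> real. mono g \<and>
          (AE \<omega> in P.
             real_cond_exp P (vimage_algebra (space P) (\<lambda>\<omega>. p \<omega> i) borel)
               (indicator {\<omega> \<in> space P. restrict (p \<omega>) (N P) \<in> A}) \<omega>
             = g (p \<omega> i))))"


definition fdp :: "nat set \<Rightarrow> nat set \<Rightarrow> real" where
  "fdp R T = real (card (R \<inter> T)) / real (max (card R) 1)"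

definition controls_FDR_set ::
  "nat \<Rightarrow> 'a measure \<Rightarrow> 'a measure set \<Rightarrow> ('a measure \<Rightarrow> nat set) \<Rightarrow> real \<Rightarrow> ('a \<Rightarrow> nat set) \<Rightarrow> bool" where
  "controls_FDR_set m \<Omega> M N \<alpha> R \<longleftrightarrow>
     R \<in> \<Omega> \<rightarrow>\<^sub>M count_space (Pow {1..m}) \<and>
     (\<forall>P\<in>M. (\<integral>\<omega>. fdp (R \<omega>) (N P) \<partial>P) \<le> \<alpha>)"

text \<open>The inserted 0 matters only for an empty collection, since \<^const>\<open>fdp\<close> is nonnegative.\<close>

definition controls_FDR_collection ::
  "nat \<Rightarrow> 'a measure \<Rightarrow> 'a measure set \<Rightarrow> ('a measure \<Rightarrow> nat set) \<Rightarrow> real \<Rightarrow> ('a \<Rightarrow> nat set set) \<Rightarrow> bool" where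
  "controls_FDR_collection m \<Omega> M N \<alpha> C \<longleftrightarrow>
     C \<in> \<Omega> \<rightarrow>\<^sub>M count_space (Pow (Pow {1..m})) \<and>
     (\<forall>P\<in>M. (\<integral>\<omega>. Max (insert 0 ((\<lambda>R. fdp R (N P)) ` C \<omega>)) \<partial>P) \<le> \<alpha>)"

text \<open>
  \<open>C\<close> and \<open>S\<close> are procedures, i.e. functions of the vector of p-values.  FDR control concerns the
  random objects \<open>C \<circ> p\<close> and \<open>S \<circ> p\<close>.  The outcomes over which ``surely'' and ``event'' range are
  the possible vectors of p-values: the p-values of a particular model may be degenerate (constantly 1,
  say), and then \<open>\<Omega>\<close> need not contain any outcome with a strict improvement.
  The event must not be empty, as otherwise the second condition would be void.
\<close>

definition uniformly_improves ::
  "nat \<Rightarrow> real set \<Rightarrow> 'a measure \<Rightarrow> 'a measure set \<Rightarrow> ('a measure \<Rightarrow> nat set) \<Rightarrow>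
   ('a \<Rightarrow> nat \<Rightarrow> real) \<Rightarrow> real \<Rightarrow>
   ((nat \<Rightarrow> real) \<Rightarrow> nat set set) \<Rightarrow> ((nat \<Rightarrow> real) \<Rightarrow> nat set) \<Rightarrow> bool" where
  "uniformly_improves m V \<Omega> M N p \<alpha> C S \<longleftrightarrow>
     controls_FDR_collection m \<Omega> M N \<alpha> (\<lambda>\<omega>. C (p \<omega>)) \<and>
     controls_FDR_set m \<Omega> M N \<alpha> (\<lambda>\<omega>. S (p \<omega>)) \<and>
     (\<forall>x\<in>space (pval_space m V). S x \<in> C x) \<and>
     (\<exists>E\<in>sets (pval_space m V). E \<noteq> {} \<and> (\<forall>x\<in>E. \<exists>R. S x \<subset> R \<and> R \<in> C x))"


text \<open>Branch \<open>-1\<close> of the Lambert W function, meaningful on \<open>[-1/e, 0)\<close>.\<close>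

definition lambert_Wm1 :: "real \<Rightarrow> real" where
  "lambert_Wm1 x = (THE y. y \<le> -1 \<and> y * exp y = x)"

definition l_const :: "real \<Rightarrow> real" where
  "l_const \<alpha> = - 1 / lambert_Wm1 (- \<alpha> / exp 1)"

text \<open>The \<open>i\<close>-th smallest, counted from 1, of the values \<open>x\<^sub>j\<close> with \<open>j \<in> S\<close>.\<close>

definition order_stat :: "(nat \<Rightarrow> real) \<Rightarrow> nat set \<Rightarrow> nat \<Rightarrow> real" where
  "order_stat x S i = sort (map x (sorted_list_of_set S)) ! (i - 1)"

definition su_count :: "nat \<Rightarrow> real \<Rightarrow> (nat \<Rightarrow> real) \<Rightarrow> nat" where
  "su_count m \<alpha> x =
     (let K = {r \<in> {1..m}. real m * order_stat x {1..m} r \<le> real r * \<alpha> * l_const \<alpha>}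
      in if K = {} then 0 else Max K)"

text \<open>
  The p-values need not be listed in increasing order.  If they are, then this is the set
  \<open>{1..su_count m \<alpha> x}\<close>, see \<open>su_set_ordered\<close> below.
\<close>

definition su_set :: "nat \<Rightarrow> real \<Rightarrow> (nat \<Rightarrow> real) \<Rightarrow> nat set" where
  "su_set m \<alpha> x =
     (let r = su_count m \<alpha> x
      in if r = 0 then {} else {i \<in> {1..m}. x i \<le> order_stat x {1..m} r})"

definition simes_p :: "(nat \<Rightarrow> real) \<Rightarrow> nat set \<Rightarrow> real" where
  "simes_p x S = Min ((\<lambda>i. real (card S) * order_stat x S i / real i) ` {1..card S})"

definition su_e :: "real \<Rightarrow> (nat \<Rightarrow> real) \<Rightarrow> nat set \<Rightarrow> real" where
  "su_e \<alpha> x S =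
     (if simes_p x S = 0 then 1 / \<alpha> else min (l_const \<alpha> / simes_p x S) (1 / \<alpha>))"

definition su_plus :: "nat \<Rightarrow> real \<Rightarrow> (nat \<Rightarrow> real) \<Rightarrow> nat set set" where
  "su_plus m \<alpha> x =
     {R \<in> Pow {1..m}. \<forall>S \<in> Pow {1..m} - {{}}.
        \<alpha> * su_e \<alpha> x S \<ge> real (card (R \<inter> S)) / real (max (card R) 1)}"


lemma order_stat_ordered:
  assumes "mono_on {1..m} x" and "r \<in> {1..m}"
  shows "order_stat x {1..m} r = x r"
proof -
  have l: "sorted_list_of_set {1..m} = [1..<Suc m]"
    by (metis atLeastLessThanSuc_atLeastAtMost sorted_list_of_set_range)
  have "sorted (map x [1..<Suc m])"
    using assms(1) by (auto simp: sorted_iff_nth_mono mono_on_def simp del: upt_Suc)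
  then show ?thesis
    using assms(2) nth_upt[of 1 "r - 1" "Suc m"]
    unfolding order_stat_def l by (auto simp: sorted_sort_id nth_map simp del: upt_Suc)
qed

lemma su_count_ordered:
  assumes "mono_on {1..m} x"
  shows "su_count m \<alpha> x =
    (let K = {r \<in> {1..m}. real m * x r \<le> real r * \<alpha> * l_const \<alpha>} in if K = {} then 0 else Max K)"
proof -
  have "{r \<in> {1..m}. real m * order_stat x {1..m} r \<le> real r * \<alpha> * l_const \<alpha>} =
        {r \<in> {1..m}. real m * x r \<le> real r * \<alpha> * l_const \<alpha>}"
    using order_stat_ordered[OF assms] by auto
  then show ?thesis by (simp only: su_count_def)
qed

lemma su_set_ordered:
  assumes mono: "mono_on {1..m} x" and pos: "\<alpha> * l_const \<alpha> \<ge> 0"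
  shows "su_set m \<alpha> x = {1..su_count m \<alpha> x}"
proof -
  define K where "K = {r \<in> {1..m}. real m * x r \<le> real r * \<alpha> * l_const \<alpha>}"
  define r where "r = su_count m \<alpha> x"
  have r: "r = (if K = {} then 0 else Max K)"
    unfolding r_def K_def su_count_ordered[OF mono] Let_def ..
  have fin: "finite K" by (simp add: K_def)
  show ?thesis
  proof (cases "r = 0")
    case True
    then show ?thesis by (simp add: su_set_def r_def Let_def)
  next
    case False
    then have "r = Max K" "K \<noteq> {}" using r by (auto split: if_splits)
    then have rK: "r \<in> K" using Max_in[OF fin] by simp
    then have rm: "r \<in> {1..m}" by (simp add: K_def)
    have ge: "i \<le> r" if i: "i \<in> {1..m}" "x i \<le> x r" for i
    proof (rule ccontr)
      assume "\<not> i \<le> r"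
      then have "real r * (\<alpha> * l_const \<alpha>) \<le> real i * (\<alpha> * l_const \<alpha>)"
        using pos by (intro mult_right_mono) auto
      moreover have "real m * x i \<le> real m * x r" using i by (intro mult_left_mono) auto
      moreover have "real m * x r \<le> real r * (\<alpha> * l_const \<alpha>)"
        using rK by (simp add: K_def mult.assoc)
      ultimately have "real m * x i \<le> real i * (\<alpha> * l_const \<alpha>)" by linarith
      then have "i \<in> K" using i by (simp add: K_def mult.assoc)
      then show False using Max_ge[OF fin] \<open>r = Max K\<close> \<open>\<not> i \<le> r\<close> by auto
    qed
    have "su_set m \<alpha> x = {i \<in> {1..m}. x i \<le> x r}"
      using False order_stat_ordered[OF mono rm] by (simp add: su_set_def r_def Let_def)
    also have "\<dots> = {1..r}"
    proof (intro set_eqI iffI)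
      fix i assume "i \<in> {i \<in> {1..m}. x i \<le> x r}"
      then show "i \<in> {1..r}" using ge[of i] by simp
    next
      fix i assume "i \<in> {1..r}"
      then have "i \<in> {1..m}" "i \<le> r" using rm by simp_all
      then show "i \<in> {i \<in> {1..m}. x i \<le> x r}" using mono_onD[OF mono _ rm] by blast
    qed
    finally show ?thesis by (simp add: r_def)
  qed
qed

end

theory Submission
  imports Defs "HOL-Real_Asymp.Real_Asymp"
begin

text \<open>
  The false discovery proportion of every set in the Su+ collection is at most \<open>\<alpha>\<close> times the e-value
  of the set \<open>N\<close> of all true hypotheses, so FDR control reduces to that e-value having mean at most 1.
  Under PRDN the Simes p-value of \<open>N\<close> is stochastically larger than uniform, and \<open>l\<close> is such that
  \<open>min (l / u) (1 / \<alpha>)\<close> has mean exactly 1 for uniform \<open>u\<close>.  If Su rejects \<open>r\<close> hypotheses, each of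
  their p-values is at most \<open>r \<alpha> l / m\<close>, so for every \<open>S\<close> the Simes p-value of \<open>S\<close> is small enough to
  admit the Su set.  The improvement is strict when all p-values but one vanish and the last one lies
  in the interval from \<open>\<alpha> l\<close> (excluded) to \<open>2 \<alpha> l\<close>.
\<close>

section \<open>The constant \<open>l_const\<close> and the Lambert W function\<close>

text \<open>On the half-line up to -1 the function \<open>y * exp y\<close> decreases strictly from
  its limit 0 at minus infinity to -1/e at -1. Hence the description in \<open>lambert_Wm1\<close>
  has exactly one solution when 0 < \<alpha> \<le> 1, and \<open>theI'\<close> applies.\<close>

lemma lambert_Wm1_bounds:
  assumes "0 < \<alpha>" "\<alpha> \<le> 1"
  shows "lambert_Wm1 (- \<alpha> / exp 1) \<le> -1"
    and "lambert_Wm1 (- \<alpha> / exp 1) * exp (lambert_Wm1 (- \<alpha> / exp 1)) = - \<alpha> / exp 1"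
proof -
  let ?x = "- \<alpha> / exp 1 :: real"
  have uniq: "y = z" if "y * exp y = z * exp z" "y \<le> -1" "z \<le> -1" for y z :: real
    using that
  proof (induction y z rule: linorder_wlog)
    case (le y z)
    show ?case
    proof (rule ccontr)
      assume "y \<noteq> z"
      then have "y < z" using le by simp
      have "z * exp z < y * exp y"
      proof (rule DERIV_neg_imp_decreasing_open[OF \<open>y < z\<close>])
        fix t assume "y < t" "t < z"
        then have "(1 + t) * exp t < 0" using le by (simp add: mult_less_0_iff)
        moreover have "((\<lambda>y. y * exp y) has_real_derivative (1 + t) * exp t) (at t)"
          by (auto intro!: derivative_eq_intros simp: algebra_simps)
        ultimately show "\<exists>d. ((\<lambda>y. y * exp y) has_real_derivative d) (at t) \<and> d < 0"
          by blast
      qed (auto intro!: continuous_intros)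
      then show False using le by simp
    qed
  qed simp
  have "((\<lambda>y::real. y * exp y) \<longlongrightarrow> 0) at_bot"
    by real_asymp
  then have "\<forall>\<^sub>F y::real in at_bot. y * exp y > ?x"
    by (rule order_tendstoD) (use assms in \<open>simp add: divide_less_0_iff\<close>)
  then have "\<forall>\<^sub>F y::real in at_bot. y * exp y > ?x \<and> y \<le> -1"
    using eventually_le_at_bot eventually_conj by blast
  \<comment> \<open>The point \<open>a\<close> is the left end for the intermediate value theorem.
    At the right end -1 the value is -1/e, which is at most \<open>?x\<close> because \<alpha> \<le>
    1.\<close>
  then obtain a :: real where a: "a * exp a > ?x" "a \<le> -1"
    using eventually_happens'[OF trivial_limit_at_bot_linorder] by blast
  have "\<exists>y\<ge>a. y \<le> -1 \<and> y * exp y = ?x"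
    by (rule IVT2) (use a assms in \<open>auto simp: exp_minus field_simps intro!: continuous_intros\<close>)
  then have "\<exists>!y. y \<le> -1 \<and> y * exp y = ?x" using uniq by (metis (no_types))
  from theI'[OF this] show "lambert_Wm1 ?x \<le> -1" "lambert_Wm1 ?x * exp (lambert_Wm1 ?x) = ?x"
    by (simp_all add: lambert_Wm1_def)
qed

text \<open>Everything follows from q = \<alpha> l = exp (w + 1), where w is the Lambert value: then
  1 - ln q = -w = 1/l, and q = 1 only for w = -1, that is, for \<alpha> = 1. Multiplied by \<alpha>,
  \<open>l_const_ln\<close> is the familiar equation \<alpha> = q - q log q; in the given form it
  normalises the mean of the e-value to 1.\<close>

lemma l_const_facts:
  assumes "0 < \<alpha>" "\<alpha> \<le> 1"
  shows l_const_pos: "0 < l_const \<alpha>"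
    and l_const_ln: "l_const \<alpha> * (1 - ln (\<alpha> * l_const \<alpha>)) = 1"
    and level_le_1: "\<alpha> * l_const \<alpha> \<le> 1"
    and level_less_1: "\<alpha> < 1 \<Longrightarrow> \<alpha> * l_const \<alpha> < 1"
proof -
  define w where "w = lambert_Wm1 (- \<alpha> / exp 1)"
  have w: "w \<le> -1" "w * exp w = - \<alpha> / exp 1"
    unfolding w_def using lambert_Wm1_bounds[OF assms] .
  have l: "l_const \<alpha> = - 1 / w" by (simp add: l_const_def w_def)
  have \<alpha>: "\<alpha> = - w * exp (w + 1)" using w(2) by (simp add: exp_add field_simps)
  then have q: "\<alpha> * l_const \<alpha> = exp (w + 1)" unfolding l using w(1) by (simp add: \<alpha>)
  show "0 < l_const \<alpha>" using w(1) by (simp add: l divide_less_0_iff)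
  show "l_const \<alpha> * (1 - ln (\<alpha> * l_const \<alpha>)) = 1" unfolding q unfolding l using w(1) by simp
  show "\<alpha> * l_const \<alpha> \<le> 1" using w(1) by (simp add: q)
  show "\<alpha> * l_const \<alpha> < 1" if "\<alpha> < 1"
  proof -
    have "w \<noteq> -1" using \<alpha> that by auto
    then show ?thesis using w(1) by (simp add: q)
  qed
qed

section \<open>Order statistics and Simes p-values as counts\<close>

text \<open>The entries up to \<open>c\<close> form an initial segment of a sorted list, so a
  position is in it exactly if it is smaller than the length of the segment.\<close>

lemma nth_le_iff_length_filter:
  fixes c :: "'a :: linorder"
  assumes "sorted xs" "k < length xs"
  shows "xs ! k \<le> c \<longleftrightarrow> k < length (filter (\<lambda>y. y \<le> c) xs)"
  using assms
proof (induction xs arbitrary: k)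
  case (Cons a xs)
  show ?case
  proof (cases "a \<le> c")
    case True
    then show ?thesis using Cons by (cases k) auto
  next
    case False
    then have "filter (\<lambda>y. y \<le> c) (a # xs) = []"
      using Cons.prems(1) by (auto simp: filter_empty_conv)
    moreover have "\<not> (a # xs) ! k \<le> c"
      using False Cons.prems nth_mem[of k "a # xs"] by (fastforce simp del: nth_mem)
    ultimately show ?thesis by simp
  qed
qed simp

text \<open>Sorting does not change how many entries are at most \<open>c\<close>. This count form
  replaces the sorted list in all later arguments, including those on measurability and
  monotonicity.\<close>

lemma order_stat_le_iff:
  assumes "finite S" "i \<in> {1..card S}"
  shows "order_stat x S i \<le> c \<longleftrightarrow> i \<le> card {j \<in> S. x j \<le> c}"
proof -
  let ?xs = "map x (sorted_list_of_set S)"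
  have "length (filter (\<lambda>y. y \<le> c) (sort ?xs)) = length (filter (\<lambda>y. y \<le> c) ?xs)"
    by (simp only: mset_filter mset_sort flip: size_mset)
  also have "\<dots> = length (filter (\<lambda>j. x j \<le> c) (sorted_list_of_set S))"
    by (simp add: filter_map comp_def)
  also have "\<dots> = card {j \<in> S. x j \<le> c}"
    by (subst distinct_card[symmetric]) (use assms in \<open>auto intro!: arg_cong[where f = card]\<close>)
  \<comment> \<open>Ranks start at 1 and list positions at 0: position \<open>i - 1\<close> is below
    the count iff \<open>i\<close> is at most the count, as \<open>i\<close> is positive.\<close>
  finally show ?thesis
    using nth_le_iff_length_filter[of "sort ?xs" "i - 1" c] assms
    by (auto simp: order_stat_def Suc_le_eq less_diff_conv2)
qed

lemma order_stat_mono: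
  assumes "finite S" "i \<in> {1..card S}" "j \<in> {1..card S}" "i \<le> j"
  shows "order_stat x S i \<le> order_stat x S j"
  using order_stat_le_iff[OF assms(1,2)] order_stat_le_iff[OF assms(1,3), of x "order_stat x S j"] assms(4)
  by simp

lemma order_stat_nonneg:
  assumes "finite S" "i \<in> {1..card S}" "\<And>j. j \<in> S \<Longrightarrow> 0 \<le> x j"
  shows "0 \<le> order_stat x S i"
proof -
  \<comment> \<open>With \<open>c\<close> equal to the order statistic itself, the count is at least
    \<open>i\<close> and hence positive.\<close>
  have "{j \<in> S. x j \<le> order_stat x S i} \<noteq> {}"
    using order_stat_le_iff[OF assms(1,2), of x "order_stat x S i"] assms(2) by (force simp del: Collect_empty_eq)
  then show ?thesis using assms(3) by force
qed

text \<open>The right-hand side says that the counts reach the Simes line at some rank. This is the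
  event treated in \<open>simes_inequality\<close>; read from right to left, a single suitable rank
  bounds a Simes p-value from above.\<close>

lemma simes_p_le_iff:
  assumes "finite S" "S \<noteq> {}"
  shows "simes_p x S \<le> v \<longleftrightarrow> (\<exists>i\<in>{1..card S}. i \<le> card {j \<in> S. x j \<le> v / real (card S) * real i})"
proof -
  have "card S \<noteq> 0" using assms by simp
  then have "simes_p x S \<le> v \<longleftrightarrow> (\<exists>i\<in>{1..card S}. real (card S) * order_stat x S i / real i \<le> v)"
    unfolding simes_p_def by (subst Min_le_iff) auto
  also have "\<dots> \<longleftrightarrow> (\<exists>i\<in>{1..card S}. order_stat x S i \<le> v / real (card S) * real i)"
    using \<open>card S \<noteq> 0\<close> by (intro bex_cong) (auto simp: field_simps)
  also have "\<dots> \<longleftrightarrow> (\<exists>i\<in>{1..card S}. i \<le> card {j \<in> S. x j \<le> v / real (card S) * real i})"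
    by (intro bex_cong) (auto simp: order_stat_le_iff[OF assms(1)])
  finally show ?thesis .
qed

lemma simes_p_nonneg:
  assumes "finite S" "S \<noteq> {}" "\<And>j. j \<in> S \<Longrightarrow> 0 \<le> x j"
  shows "0 \<le> simes_p x S"
proof -
  have "card S \<noteq> 0" using assms by simp
  then show ?thesis
    unfolding simes_p_def using order_stat_nonneg[OF assms(1) _ assms(3)]
    by (subst Min_ge_iff) (auto simp del: atLeastAtMost_iff)
qed

section \<open>The e-values of Su+\<close>

lemma simes_p_pos_imp_e:
  assumes "0 < \<alpha>" "0 < simes_p x S"
  shows "\<alpha> * su_e \<alpha> x S = min (\<alpha> * l_const \<alpha> / simes_p x S) 1"
  using assms by (auto simp: su_e_def min_def field_simps)

lemma su_e_zero:
  assumes "0 < \<alpha>" "simes_p x S = 0"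
  shows "\<alpha> * su_e \<alpha> x S = 1"
  using assms by (auto simp: su_e_def)

lemma su_e_bounds:
  assumes "0 < \<alpha>" "\<alpha> \<le> 1" "0 \<le> simes_p x S"
  shows "0 \<le> \<alpha> * su_e \<alpha> x S" "\<alpha> * su_e \<alpha> x S \<le> 1"
  using assms l_const_pos[OF assms(1,2)] by (auto simp: su_e_def min_def field_simps)

text \<open>The criterion for membership in Su+. The product form of the hypothesis avoids dividing
  by a Simes p-value that may be 0, and \<open>r \<le> 1\<close> takes care of the truncation at
  1/\<alpha>.\<close>

lemma level_le_su_e:
  assumes "0 < \<alpha>" "0 \<le> simes_p x S" "simes_p x S * r \<le> \<alpha> * l_const \<alpha>" "r \<le> 1"
  shows "r \<le> \<alpha> * su_e \<alpha> x S"
proof (cases "simes_p x S = 0")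
  case True
  then show ?thesis using assms by (simp add: su_e_zero)
next
  case False
  then show ?thesis using assms by (simp add: simes_p_pos_imp_e field_simps)
qed

section \<open>Su belongs to Su+\<close>

text \<open>Order statistics grow with the rank, so the largest admissible rank has the weakest
  threshold and the maximum may be traded for an existential quantifier. The case without admissible
  rank then needs no separate treatment.\<close>

lemma su_set_iff:
  assumes "i \<in> {1..m}"
  shows "i \<in> su_set m \<alpha> x \<longleftrightarrow> (\<exists>r\<in>{1..m}. real m * order_stat x {1..m} r \<le> real r * \<alpha> * l_const \<alpha>
           \<and> x i \<le> order_stat x {1..m} r)"
proof -
  define K where "K = {r \<in> {1..m}. real m * order_stat x {1..m} r \<le> real r * \<alpha> * l_const \<alpha>}"
  have fin: "finite K" by (simp add: K_def)
  have c: "su_count m \<alpha> x = (if K = {} then 0 else Max K)"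
    unfolding su_count_def K_def Let_def ..
  have "i \<in> su_set m \<alpha> x \<longleftrightarrow> (\<exists>r\<in>K. x i \<le> order_stat x {1..m} r)"
  proof (cases "K = {}")
    case True
    then show ?thesis using c by (simp add: su_set_def)
  next
    case False
    have M: "Max K \<in> K" using fin False by simp
    then have "Max K \<in> {1..m}" by (simp add: K_def)
    then have s: "i \<in> su_set m \<alpha> x \<longleftrightarrow> x i \<le> order_stat x {1..m} (Max K)"
      using assms False by (simp add: su_set_def c)
    show ?thesis
    proof
      assume "\<exists>r\<in>K. x i \<le> order_stat x {1..m} r"
      then obtain r where r: "r \<in> K" "x i \<le> order_stat x {1..m} r" by blast
      then have "r \<in> {1..m}" "r \<le> Max K" using fin by (simp_all add: K_def)
      then have "order_stat x {1..m} r \<le> order_stat x {1..m} (Max K)"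
        using \<open>Max K \<in> {1..m}\<close> by (intro order_stat_mono) simp_all
      then show "i \<in> su_set m \<alpha> x" using r s by simp
    qed (use s M in blast)
  qed
  then show ?thesis by (auto simp: K_def)
qed

lemma su_set_subset: "su_set m \<alpha> x \<subseteq> {1..m}"
  by (auto simp: su_set_def Let_def)

text \<open>Self-consistency of Su: if rank \<open>r\<close> witnesses the rejection of
  \<open>i\<close>, the same \<open>r\<close> witnesses the rejection of all hypotheses up to the
  \<open>r\<close>-th order statistic. There are at least \<open>r\<close> of these, so
  \<open>r\<close> may be replaced by the number of rejections.\<close>

lemma su_set_bound:
  assumes "0 < \<alpha>" "\<alpha> \<le> 1" "i \<in> su_set m \<alpha> x"
  shows "real m * x i \<le> real (card (su_set m \<alpha> x)) * (\<alpha> * l_const \<alpha>)"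
proof -
  have i: "i \<in> {1..m}" using assms(3) su_set_subset by blast
  then obtain r where r: "r \<in> {1..m}" "real m * order_stat x {1..m} r \<le> real r * \<alpha> * l_const \<alpha>"
     "x i \<le> order_stat x {1..m} r"
    using assms(3) su_set_iff by blast
  have "r \<le> card {j \<in> {1..m}. x j \<le> order_stat x {1..m} r}"
    using order_stat_le_iff[of "{1..m}" r x "order_stat x {1..m} r"] r(1) by simp
  also have "\<dots> \<le> card (su_set m \<alpha> x)"
  proof (rule card_mono)
    show "finite (su_set m \<alpha> x)" using su_set_subset by (rule finite_subset) simp
    show "{j \<in> {1..m}. x j \<le> order_stat x {1..m} r} \<subseteq> su_set m \<alpha> x"
      using r su_set_iff by blast
  qed
  finally have "real r * (\<alpha> * l_const \<alpha>) \<le> real (card (su_set m \<alpha> x)) * (\<alpha> * l_const \<alpha>)"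
    using assms l_const_pos[of \<alpha>] by (intro mult_right_mono) auto
  moreover have "real m * x i \<le> real m * order_stat x {1..m} r"
    using r by (intro mult_left_mono) auto
  ultimately show ?thesis using r(2) by (simp add: mult.assoc)
qed

text \<open>With k the size of \<open>R \<inter> S\<close>, at least k p-values in \<open>S\<close>
  lie below the common threshold of Su. Rank k in the Simes minimum then gives a bound that is
  exactly small enough for \<open>level_le_su_e\<close>.\<close>

lemma su_set_in_su_plus:
  assumes "0 < \<alpha>" "\<alpha> \<le> 1" "\<And>i. i \<in> {1..m} \<Longrightarrow> 0 \<le> x i"
  shows "su_set m \<alpha> x \<in> su_plus m \<alpha> x"
proof -
  define R where "R = su_set m \<alpha> x"
  define q where "q = \<alpha> * l_const \<alpha>"
  have q: "0 < q" using assms l_const_pos[of \<alpha>] by (simp add: q_def)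
  have finR: "finite R" unfolding R_def using su_set_subset by (rule finite_subset) simp
  have "real (card (R \<inter> S)) / real (max (card R) 1) \<le> \<alpha> * su_e \<alpha> x S"
    if S: "S \<subseteq> {1..m}" "S \<noteq> {}" for S
  proof -
    have finS: "finite S" using S(1) by (rule finite_subset) simp
    have pS: "0 \<le> simes_p x S" using finS S assms(3) by (intro simes_p_nonneg) auto
    define k where "k = card (R \<inter> S)"
    define n where "n = card S"
    have n: "0 < n" using finS S by (simp add: n_def card_gt_0_iff)
    have nm: "n \<le> m" using card_mono[OF _ S(1)] by (simp add: n_def)
    have kR: "k \<le> card R" unfolding k_def using finR by (intro card_mono) auto
    have kn: "k \<le> n" unfolding k_def n_def using finS by (intro card_mono) auto
    show ?thesis
    proof (cases "k = 0")
      case True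
      then show ?thesis using su_e_bounds[OF assms(1,2) pS] by (simp add: k_def)
    next
      case False
      \<comment> \<open>Chosen so that the Simes line at rank \<open>k\<close> has height
        \<open>card R * q / n\<close> and so that \<open>v * (k / card R) = q\<close>.\<close>
      define v where "v = real (card R) * q / k"
      have "x j \<le> v / n * k" if "j \<in> R" for j
      proof -
        have "real m * x j \<le> real (card R) * q"
          using su_set_bound[OF assms(1,2)] that by (simp add: R_def q_def)
        \<comment> \<open>Passing from \<open>m\<close> to the smaller \<open>n\<close> only raises
          the threshold; this uses that p-values are nonnegative.\<close>
        moreover have "real n * x j \<le> real m * x j"
          using that nm assms(3)[of j] su_set_subset[of m \<alpha> x]
          by (intro mult_right_mono) (auto simp: R_def subset_iff)
        ultimately show ?thesis using False n by (simp add: v_def field_simps)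
      qed
      then have "R \<inter> S \<subseteq> {j \<in> S. x j \<le> v / real (card S) * real k}" by (auto simp: n_def)
      then have "k \<le> card {j \<in> S. x j \<le> v / real (card S) * real k}"
        unfolding k_def using finS by (intro card_mono) auto
      then have "simes_p x S \<le> v"
        using simes_p_le_iff[OF finS S(2)] False kn by (auto simp: n_def intro!: bexI[of _ k])
      then have "simes_p x S * (k / card R) \<le> v * (k / card R)"
        by (intro mult_right_mono) auto
      also have "\<dots> = q" using False kR by (simp add: v_def)
      finally have "k / card R \<le> \<alpha> * su_e \<alpha> x S"
        using kR False by (intro level_le_su_e assms pS) (auto simp: q_def)
      moreover have "max (card R) 1 = card R" using kR False by simp
      ultimately show ?thesis by (simp add: k_def)
    qed
  qed
  then show ?thesis using su_set_subset by (auto simp: su_plus_def R_def)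
qed

section \<open>An outcome with strict improvement\<close>

text \<open>Su compares the last p-value with at most q, and \<open>y\<close> is larger. In Su+,
  every \<open>S\<close> with a vanishing p-value has the maximal e-value 1/\<alpha>, so the only
  critical set is \<open>{m}\<close>; there only the proportion 1/m has to be allowed, which leaves
  room up to m q.\<close>

lemma su_plus_strict:
  assumes "m > 1" "0 < \<alpha>" "\<alpha> \<le> 1" and y: "\<alpha> * l_const \<alpha> < y" "y \<le> 2 * (\<alpha> * l_const \<alpha>)"
    and x: "\<And>i. i \<in> {1..<m} \<Longrightarrow> x i = 0" "x m = y"
  shows "su_set m \<alpha> x \<subset> {1..m}" "{1..m} \<in> su_plus m \<alpha> x"
proof -
  define q where "q = \<alpha> * l_const \<alpha>"
  have q: "0 < q" using assms l_const_pos[of \<alpha>] by (simp add: q_def)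
  have nonneg: "0 \<le> x i" if "i \<in> {1..m}" for i
    using that x y q by (cases "i = m") (auto simp: q_def)
  have "m \<notin> su_set m \<alpha> x"
  proof
    assume "m \<in> su_set m \<alpha> x"
    then have "real m * y \<le> real (card (su_set m \<alpha> x)) * q"
      using su_set_bound[OF assms(2,3)] x(2) by (force simp: q_def)
    also have "\<dots> \<le> real m * q"
      using card_mono[OF _ su_set_subset[of m \<alpha> x]] q by (intro mult_right_mono) auto
    finally show False using y(1) assms(1) by (simp add: q_def)
  qed
  then show "su_set m \<alpha> x \<subset> {1..m}" using su_set_subset assms(1) by fastforce
  have "card S / m \<le> \<alpha> * su_e \<alpha> x S" if S: "S \<subseteq> {1..m}" "S \<noteq> {}" for S
  proof -
    have finS: "finite S" using S(1) by (rule finite_subset) simp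
    have pS: "0 \<le> simes_p x S" using finS S nonneg by (intro simes_p_nonneg) auto
    have c: "card S \<le> m" using card_mono[OF _ S(1)] by simp
    have c0: "0 < card S" using finS S by (simp add: card_gt_0_iff)
    show ?thesis
    proof (cases "S = {m}")
      case True
      have "simes_p x S \<le> y"
        by (subst simes_p_le_iff) (auto simp: True x(2) Suc_le_eq card_gt_0_iff intro!: bexI[of _ 1])
      then have "simes_p x S * (card S / m) \<le> y / m"
        using True assms(1) by (simp add: divide_right_mono)
      also have "\<dots> \<le> q"
      proof -
        \<comment> \<open>Here \<open>m > 1\<close> enters: 2 q is at most m q.\<close>
        have "y \<le> m * q" using y(2) q assms(1) mult_right_mono[of 2 "real m" q] by (simp add: q_def)
        then show ?thesis using assms(1) by (simp add: field_simps)
      qed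
      finally show ?thesis using c assms by (intro level_le_su_e pS) (auto simp: q_def)
    next
      case False
      then obtain j where j: "j \<in> S" "j \<in> {1..<m}" using S by fastforce
      \<comment> \<open>Rank 1 suffices, because \<open>S\<close> contains an index with p-value
        0.\<close>
      have "simes_p x S \<le> 0"
        by (subst simes_p_le_iff[OF finS S(2)])
          (use j x(1)[OF j(2)] finS c0 in \<open>force simp: Suc_le_eq card_gt_0_iff intro!: bexI[of _ 1]\<close>)
      then have "simes_p x S = 0" using pS by simp
      then show ?thesis using c assms by (simp add: su_e_zero)
    qed
  qed
  moreover have "{1..m} \<inter> S = S" if "S \<subseteq> {1..m}" for S using that by blast
  ultimately show "{1..m} \<in> su_plus m \<alpha> x"
    using assms(1) by (auto simp: su_plus_def max_def)
qed

section \<open>The Simes inequality under PRDN\<close>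

text \<open>
  In the proof of \<open>simes_inequality\<close>, with events \<open>D\<^sub>k\<close> increasing in \<open>k\<close>: \<open>a k = P(p\<^sub>i \<le> c k)\<close>,
  \<open>b k = P(p\<^sub>i \<le> c k, D\<^sub>k)\<close> and \<open>d k = P(p\<^sub>i \<le> c (k + 1), D\<^sub>k)\<close>.  The hypothesis on ratios says
  that \<open>P(D\<^sub>k | p\<^sub>i \<le> t)\<close> grows with \<open>t\<close>, which makes the sum telescope.  If \<open>a n = 0\<close>, the bound
  is 0 by the convention \<open>x / 0 = 0\<close>, and the sum is also at most 0.
\<close>
lemma weighted_increments_le:
  fixes a b d :: "nat \<Rightarrow> real" and c :: real
  assumes "0 \<le> c" and nonneg: "\<And>k. 0 \<le> d k" "0 \<le> b 0"
    and le: "\<And>k. d k \<le> b (Suc k)" "\<And>k. b k \<le> a k"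
    and mono: "\<And>k. a k \<le> a (Suc k)"
    and bound: "\<And>k. k < n \<Longrightarrow> a (Suc k) \<le> c * Suc k"
    and ratio: "\<And>k. k < n \<Longrightarrow> b k * a (Suc k) \<le> d k * a k"
  shows "(\<Sum>k<n. (b (Suc k) - d k) / Suc k) \<le> c * (b n / a n)"
  using bound ratio
proof (induction n)
  case 0
  have "0 \<le> b 0 / a 0" using nonneg(2) le(2)[of 0] by simp
  then show ?case using mult_nonneg_nonneg[OF \<open>0 \<le> c\<close>] by fastforce
next
  case (Suc n)
  have bn: "0 \<le> b n" using nonneg le(1) order_trans by (cases n) blast+
  have an: "0 \<le> a n" using bn le(2)[of n] by simp
  have IH: "(\<Sum>k<n. (b (Suc k) - d k) / Suc k) \<le> c * (b n / a n)"
    using Suc by simp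
  show ?case
  proof (cases "a (Suc n) = 0")
    case True
    then have "a n = 0" using an mono[of n] by simp
    moreover have "b (Suc n) = d n"
      using True le(1)[of n] le(2)[of "Suc n"] nonneg(1)[of n] by simp
    ultimately show ?thesis using IH True by simp
  next
    case False
    then have pos: "0 < a (Suc n)" using an mono[of n] by simp
    have "b n / a n \<le> d n / a (Suc n)"
    proof (cases "a n = 0")
      case False
      then show ?thesis using Suc.prems(2)[of n] an pos by (simp add: field_simps)
    qed (use nonneg(1)[of n] pos in simp)
    then have "c * (b n / a n) \<le> c * (d n / a (Suc n))"
      using \<open>0 \<le> c\<close> by (rule mult_left_mono)
    \<comment> \<open>The ratio at \<open>n\<close> is absorbed by the part \<open>d n\<close> of
      the numerator at \<open>Suc n\<close>; the remaining part pays for the new summand, since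
      \<open>a (Suc n) \<le> c * Suc n\<close>.\<close>
    moreover have "(b (Suc n) - d n) / Suc n \<le> c * ((b (Suc n) - d n) / a (Suc n))"
    proof -
      have "(b (Suc n) - d n) * a (Suc n) \<le> (b (Suc n) - d n) * (c * Suc n)"
        using Suc.prems(1)[of n] le(1)[of n] by (intro mult_left_mono) auto
      then show ?thesis using pos by (simp add: field_simps)
    qed
    ultimately show ?thesis using IH by (simp add: diff_divide_distrib algebra_simps)
  qed
qed

context prob_space
begin

text \<open>The conditional probability of \<open>B\<close> averages to at most \<open>g s\<close>
  over \<open>X \<le> s\<close> and to at least \<open>g s\<close> over
  \<open>s < X \<le> t\<close>, so enlarging the conditioning event from the former to
  \<open>X \<le> t\<close> cannot lower it. Cross-multiplication keeps the claim meaningful for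
  conditioning events of probability 0.\<close>

lemma mono_cond_prob_ratio:
  fixes X :: "'a \<Rightarrow> real" and g :: "real \<Rightarrow> real"
  assumes X[measurable]: "X \<in> borel_measurable M" and B[measurable]: "B \<in> sets M" and g: "mono g"
    and AE: "AE \<omega> in M. real_cond_exp M (vimage_algebra (space M) X borel) (indicator B) \<omega> = g (X \<omega>)"
    and "s \<le> t"
  shows "prob ({\<omega> \<in> space M. X \<omega> \<le> s} \<inter> B) * prob {\<omega> \<in> space M. X \<omega> \<le> t}
       \<le> prob ({\<omega> \<in> space M. X \<omega> \<le> t} \<inter> B) * prob {\<omega> \<in> space M. X \<omega> \<le> s}"
proof -
  let ?F = "vimage_algebra (space M) X borel"
  have "subalgebra M ?F"
    unfolding subalgebra_def using measurable_iff_sets[of X M borel] X by simp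
  then interpret F: finite_measure_subalgebra M ?F
    by unfold_locales
  have [measurable]: "g \<in> borel_measurable borel" using g by (rule borel_measurable_mono)
  have ind: "integrable M (indicator B :: _ \<Rightarrow> real)"
    by (simp add: emeasure_eq_measure)
  have int_g: "integrable M (\<lambda>\<omega>. g (X \<omega>))"
    using F.real_cond_exp_int(1)[OF ind] integrable_cong_AE[OF _ _ AE] by simp
  \<comment> \<open>The defining property of conditional expectation: over events determined by
    \<open>X\<close>, the indicator of \<open>B\<close> and \<open>g (X \<omega>)\<close> have the
    same integral.\<close>
  have *: "prob ((X -` A \<inter> space M) \<inter> B) = (\<integral>\<omega>\<in>X -` A \<inter> space M. g (X \<omega>) \<partial>M)"
    if [measurable]: "A \<in> sets borel" for A
  proof -
    have "prob ((X -` A \<inter> space M) \<inter> B) = (\<integral>\<omega>. indicator ((X -` A \<inter> space M) \<inter> B) \<omega> \<partial>M)"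
      by simp
    also have "\<dots> = (\<integral>\<omega>\<in>X -` A \<inter> space M. indicator B \<omega> \<partial>M)"
      unfolding set_lebesgue_integral_def by (simp add: indicator_inter_arith)
    also have "\<dots> = (\<integral>\<omega>\<in>X -` A \<inter> space M. real_cond_exp M ?F (indicator B) \<omega> \<partial>M)"
      using that by (intro F.real_cond_exp_intA ind in_vimage_algebra)
    also have "\<dots> = (\<integral>\<omega>\<in>X -` A \<inter> space M. g (X \<omega>) \<partial>M)"
      unfolding set_lebesgue_integral_def
      by (intro integral_cong_AE) (use AE in auto)
    finally show ?thesis .
  qed
  have const: "(\<integral>\<omega>\<in>X -` A \<inter> space M. c \<partial>M) = c * prob (X -` A \<inter> space M)"
    if [measurable]: "A \<in> sets borel" for A c
    unfolding set_lebesgue_integral_def by simp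
  have sint: "set_integrable M (X -` A \<inter> space M) (\<lambda>\<omega>. g (X \<omega>))"
     "set_integrable M (X -` A \<inter> space M) (\<lambda>\<omega>. c)"
    if [measurable]: "A \<in> sets borel" for A and c :: real
    unfolding set_integrable_def
    by (intro integrable_mult_indicator int_g integrable_const; measurable)+
  let ?a = "prob (X -` {..s} \<inter> space M)" and ?b = "prob (X -` {s<..t} \<inter> space M)"
  let ?x = "prob ((X -` {..s} \<inter> space M) \<inter> B)" and ?y = "prob ((X -` {s<..t} \<inter> space M) \<inter> B)"
  have x: "?x \<le> g s * ?a"
    unfolding *[of "{..s}", simplified] const[of "{..s}", simplified, symmetric]
    by (intro set_integral_mono sint) (use monoD[OF g] in auto)
  have y: "g s * ?b \<le> ?y"
    unfolding *[of "{s<..t}", simplified] const[of "{s<..t}", simplified, symmetric]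
    by (intro set_integral_mono sint) (use monoD[OF g] in auto)
  have "?x * ?b \<le> g s * ?a * ?b" using x by (intro mult_right_mono) auto
  also have "\<dots> = (g s * ?b) * ?a" by simp
  also have "\<dots> \<le> ?y * ?a" using y by (intro mult_right_mono) auto
  finally have xy: "?x * ?b \<le> ?y * ?a" .
  have S: "{\<omega> \<in> space M. X \<omega> \<le> s} = X -` {..s} \<inter> space M" by auto
  have T: "{\<omega> \<in> space M. X \<omega> \<le> t} = (X -` {..s} \<inter> space M) \<union> (X -` {s<..t} \<inter> space M)"
    using \<open>s \<le> t\<close> by auto
  have 1: "prob {\<omega> \<in> space M. X \<omega> \<le> t} = ?a + ?b"
    unfolding T by (intro finite_measure_Union) auto
  have 2: "prob ({\<omega> \<in> space M. X \<omega> \<le> t} \<inter> B) = ?x + ?y"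
    unfolding T Int_Un_distrib2 by (intro finite_measure_Union) auto
  \<comment> \<open>After expansion, \<open>?x * ?a\<close> cancels on both sides and
    \<open>xy\<close> remains.\<close>
  show ?thesis unfolding 1 2 using xy unfolding S by (simp add: algebra_simps)
qed

text \<open>The crossing event is split by the last rank at which the counts reach the line. At last
  rank k + 1 at least k + 1 p-values are below the line, so giving each of them weight 1/(k + 1)
  covers the event. For a fixed hypothesis these contributions sum to at most v/n by
  \<open>weighted_increments_le\<close>, and there are n hypotheses. The assumption
  \<open>dep\<close> is the form in which PRDN enters.\<close>

lemma simes_inequality:
  fixes X :: "'i \<Rightarrow> 'a \<Rightarrow> real" and v :: real
  assumes "finite N" "N \<noteq> {}" and v: "0 \<le> v" "v \<le> 1"
    and X[measurable]: "\<And>i. i \<in> N \<Longrightarrow> X i \<in> borel_measurable M"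
    and valid: "\<And>i t. i \<in> N \<Longrightarrow> 0 \<le> t \<Longrightarrow> t \<le> 1 \<Longrightarrow> prob {\<omega> \<in> space M. X i \<omega> \<le> t} \<le> t"
    and dep: "\<And>i k s t. i \<in> N \<Longrightarrow> s \<le> t \<Longrightarrow>
       let B = {\<omega> \<in> space M. \<forall>j\<in>{k<..card N}. card {i \<in> N. X i \<omega> \<le> v / card N * j} < j} in
       prob ({\<omega> \<in> space M. X i \<omega> \<le> s} \<inter> B) * prob {\<omega> \<in> space M. X i \<omega> \<le> t}
       \<le> prob ({\<omega> \<in> space M. X i \<omega> \<le> t} \<inter> B) * prob {\<omega> \<in> space M. X i \<omega> \<le> s}"
  shows "prob {\<omega> \<in> space M. \<exists>j\<in>{1..card N}. j \<le> card {i \<in> N. X i \<omega> \<le> v / real (card N) * real j}} \<le> v"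
proof -
  define n where "n = card N"
  define c where "c = v / n"
  define F where "F i k = {\<omega> \<in> space M. X i \<omega> \<le> c * real k}" for i k
  \<comment> \<open>\<open>D k\<close> grows from the complement of the crossing event at
    \<open>k = 0\<close> to the whole space at \<open>k = n\<close>; the difference of neighbours
    holds the outcomes whose last crossing has rank \<open>k + 1\<close>.\<close>
  define D where "D k = {\<omega> \<in> space M. \<forall>j\<in>{k<..n}. card {i \<in> N. X i \<omega> \<le> c * real j} < j}" for k
  have n: "0 < n" using assms by (simp add: n_def card_gt_0_iff)
  have c: "0 \<le> c" "c * n = v" using v n by (simp_all add: c_def)
  have [measurable]: "F i k \<in> events" if [measurable]: "i \<in> N" for i k
    unfolding F_def by measurable
  \<comment> \<open>Sums of indicators make the counts accessible to measurability and to
    integration.\<close>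
  have card_sum: "real (card {i \<in> N. X i \<omega> \<le> c * real j}) = (\<Sum>i\<in>N. indicator (F i j) \<omega>)"
    if "\<omega> \<in> space M" for \<omega> j
    using that \<open>finite N\<close> by (simp add: indicator_def F_def sum.If_cases Int_def)
  have D_eq: "D k = {\<omega> \<in> space M. \<forall>j\<in>{k<..n}. (\<Sum>i\<in>N. indicator (F i j) \<omega> :: real) < real j}" for k
    unfolding D_def by (auto simp flip: card_sum)
  have [measurable]: "D k \<in> events" for k
    unfolding D_eq by measurable
  have D_mono: "D k \<subseteq> D (Suc k)" for k
    unfolding D_def by auto
  have F_mono: "F i k \<subseteq> F i (Suc k)" for i k
    unfolding F_def using c(1) mult_left_mono[OF _ c(1), of "real k" "real (Suc k)"] by auto
  have Dn: "D n = space M" by (auto simp: D_def)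
  have step: "prob (D (Suc k)) - prob (D k) \<le>
      (\<Sum>i\<in>N. (prob (F i (Suc k) \<inter> D (Suc k)) - prob (F i (Suc k) \<inter> D k)) / Suc k)" if "k < n" for k
  proof -
    have "prob (D (Suc k)) - prob (D k) = prob (D (Suc k) - D k)"
      using D_mono by (subst finite_measure_Diff) auto
    also have "\<dots> = (\<integral>\<omega>. indicator (D (Suc k) - D k) \<omega> \<partial>M)" by simp
    also have "\<dots> \<le> (\<integral>\<omega>. (\<Sum>i\<in>N. indicator (F i (Suc k) \<inter> (D (Suc k) - D k)) \<omega> / Suc k) \<partial>M)"
    proof (rule integral_mono)
      fix \<omega> assume \<omega>: "\<omega> \<in> space M"
      show "indicator (D (Suc k) - D k) \<omega> \<le>
        (\<Sum>i\<in>N. indicator (F i (Suc k) \<inter> (D (Suc k) - D k)) \<omega> / real (Suc k))"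
      proof (cases "\<omega> \<in> D (Suc k) - D k")
        case True
        then have "\<omega> \<in> space M" and all: "\<forall>j\<in>{Suc k<..n}. card {i \<in> N. X i \<omega> \<le> c * real j} < j"
          and "\<not> (\<forall>j\<in>{k<..n}. card {i \<in> N. X i \<omega> \<le> c * real j} < j)"
          unfolding D_def by blast+
        then obtain j where j: "k < j" "j \<le> n" "\<not> card {i \<in> N. X i \<omega> \<le> c * real j} < j" by auto
        moreover have "\<not> Suc k < j" using j all by auto
        ultimately have "j = Suc k" by simp
        then have "Suc k \<le> card {i \<in> N. X i \<omega> \<le> c * real (Suc k)}"
          using j(3) by (simp only: not_less)
        \<comment> \<open>At least \<open>Suc k\<close> of the events \<open>F i (Suc k)\<close>
          occur, so their weights add up to at least 1.\<close>
        then have "real (Suc k) \<le> (\<Sum>i\<in>N. indicator (F i (Suc k)) \<omega>)"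
          unfolding card_sum[OF \<omega>, symmetric] by linarith
        then show ?thesis using True
          by (simp add: sum_divide_distrib[symmetric] indicator_inter_arith divide_le_eq le_divide_eq del: of_nat_Suc)
      qed (auto intro!: sum_nonneg)
    qed (auto intro!: integrable_real_indicator simp: emeasure_eq_measure)
    also have "\<dots> = (\<Sum>i\<in>N. prob (F i (Suc k) \<inter> (D (Suc k) - D k)) / Suc k)"
      by (subst Bochner_Integration.integral_sum) (auto simp: emeasure_eq_measure intro!: sum.cong)
    also have "\<dots> = (\<Sum>i\<in>N. (prob (F i (Suc k) \<inter> D (Suc k)) - prob (F i (Suc k) \<inter> D k)) / Suc k)"
    proof (intro sum.cong refl arg_cong2[where f = "(/)"])
      fix i assume [measurable]: "i \<in> N"
      have "F i (Suc k) \<inter> (D (Suc k) - D k) = (F i (Suc k) \<inter> D (Suc k)) - (F i (Suc k) \<inter> D k)" by blast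
      then show "prob (F i (Suc k) \<inter> (D (Suc k) - D k)) = prob (F i (Suc k) \<inter> D (Suc k)) - prob (F i (Suc k) \<inter> D k)"
        using D_mono[of k] by (simp, subst finite_measure_Diff) auto
    qed
    finally show ?thesis .
  qed
  have inner: "(\<Sum>k<n. (prob (F i (Suc k) \<inter> D (Suc k)) - prob (F i (Suc k) \<inter> D k)) / Suc k) \<le> c"
    if [measurable]: "i \<in> N" for i
  proof -
    have "(\<Sum>k<n. (prob (F i (Suc k) \<inter> D (Suc k)) - prob (F i (Suc k) \<inter> D k)) / Suc k)
       \<le> c * (prob (F i n \<inter> D n) / prob (F i n))"
    proof (rule weighted_increments_le[OF c(1)])
      fix k
      show "prob (F i (Suc k) \<inter> D k) \<le> prob (F i (Suc k) \<inter> D (Suc k))"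
        using D_mono[of k] by (intro finite_measure_mono) auto
      show "prob (F i k \<inter> D k) \<le> prob (F i k)" by (intro finite_measure_mono) auto
      show "prob (F i k) \<le> prob (F i (Suc k))" using F_mono by (intro finite_measure_mono) auto
      assume "k < n"
      \<comment> \<open>All thresholds stay below \<open>c * n = v \<le> 1\<close>, the range in
        which validity of the p-values is assumed.\<close>
      then have "c * real (Suc k) \<le> c * n" using c(1) by (intro mult_left_mono) auto
      then show "prob (F i (Suc k)) \<le> c * real (Suc k)"
        unfolding F_def using that c v by (intro valid) auto
      have "c * real k \<le> c * real (Suc k)" using c(1) by (intro mult_left_mono) auto
      from dep[OF that this, of k, folded n_def, folded c_def, folded D_def, folded F_def]
      show "prob (F i k \<inter> D k) * prob (F i (Suc k)) \<le> prob (F i (Suc k) \<inter> D k) * prob (F i k)"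
        by (simp only: Let_def)
    qed auto
    also have "F i n \<inter> D n = F i n" by (auto simp: Dn F_def)
    \<comment> \<open>The quotient is 1, or 0 by convention if the probability vanishes.\<close>
    also have "c * (prob (F i n) / prob (F i n)) \<le> c * 1"
      by (intro mult_left_mono c) (simp add: divide_self_if)
    finally show ?thesis by simp
  qed
  have "{\<omega> \<in> space M. \<exists>j\<in>{1..card N}. j \<le> card {i \<in> N. X i \<omega> \<le> v / real (card N) * real j}} = space M - D 0"
    unfolding D_def n_def[symmetric] c_def[symmetric] 
    by (auto simp: not_less Suc_le_eq Bex_def Ball_def)
  also have "prob (space M - D 0) = prob (D n) - prob (D 0)"
    unfolding Dn by (subst finite_measure_Diff) (use sets.sets_into_space[of "D 0"] in auto)
  also have "\<dots> = (\<Sum>k<n. prob (D (Suc k)) - prob (D k))"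
    by (rule sum_lessThan_telescope[symmetric])
  also have "\<dots> \<le> (\<Sum>k<n. \<Sum>i\<in>N. (prob (F i (Suc k) \<inter> D (Suc k)) - prob (F i (Suc k) \<inter> D k)) / Suc k)"
    by (intro sum_mono step) simp
  also have "\<dots> = (\<Sum>i\<in>N. \<Sum>k<n. (prob (F i (Suc k) \<inter> D (Suc k)) - prob (F i (Suc k) \<inter> D k)) / Suc k)"
    by (rule sum.swap)
  also have "\<dots> \<le> (\<Sum>i\<in>N. c)" by (intro sum_mono inner)
  also have "\<dots> = v" using c(2) by (simp add: n_def mult.commute)
  finally show ?thesis .
qed

text \<open>
  For \<open>u \<le> 1\<close>, \<open>l / max q u\<close> is \<open>l\<close> plus the integral of \<open>l / v\<^sup>2\<close> over \<open>v \<in> {q..1}\<close> with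
  \<open>u \<le> v\<close>; for larger \<open>u\<close> it is at most \<open>l\<close>.
\<close>
lemma expectation_truncated_inverse_le:
  fixes U :: "'a \<Rightarrow> real"
  assumes U[measurable]: "U \<in> borel_measurable M"
    and q: "0 < q" "q \<le> 1" and "0 < l"
    and valid: "\<And>v. 0 \<le> v \<Longrightarrow> v \<le> 1 \<Longrightarrow> prob {\<omega> \<in> space M. U \<omega> \<le> v} \<le> v"
  shows "(\<integral>\<omega>. l / max q (U \<omega>) \<partial>M) \<le> l * (1 - ln q)"
proof -
  define h where "h v = indicator {q..1} v * (l / v^2)" for v :: real
  have [measurable]: "h \<in> borel_measurable borel" unfolding h_def by measurable
  have h0: "0 \<le> h v" for v using \<open>0 < l\<close> by (simp add: h_def)
  have point: "ennreal (l / max q u) \<le> ennreal l + (\<integral>\<^sup>+v. ennreal (h v) * indicator {u..} v \<partial>lborel)" for u :: real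
  proof (cases "u \<le> 1")
    case True
    define w where "w = max q u"
    have w: "0 < w" "w \<le> 1" using q True by (auto simp: w_def)
    have "(\<integral>\<^sup>+v. ennreal (h v) * indicator {u..} v \<partial>lborel) = (\<integral>\<^sup>+v. ennreal (l / v^2) * indicator {w..1} v \<partial>lborel)"
      by (intro nn_integral_cong) (auto simp: h_def indicator_def w_def)
    also have "\<dots> = ennreal (- l / 1 - - l / w)"
    proof (rule nn_integral_FTC_Icc[where F = "\<lambda>x. - l / x"])
      show "((\<lambda>x. - l / x) has_real_derivative l / x\<^sup>2) (at x)" if "x \<in> {w..1}" for x
        using that w by (auto intro!: derivative_eq_intros simp: power2_eq_square)
    qed (use w \<open>0 < l\<close> in auto)
    finally have "(\<integral>\<^sup>+v. ennreal (h v) * indicator {u..} v \<partial>lborel) = ennreal (l / w - l)" by simp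
    moreover have "l \<le> l / w" using w \<open>0 < l\<close> by (simp add: field_simps)
    ultimately show ?thesis using \<open>0 < l\<close> by (simp flip: w_def ennreal_plus)
  next
    case False
    then have "l / max q u \<le> l" using \<open>0 < l\<close> q by (simp add: divide_le_eq max_def)
    then have "ennreal (l / max q u) \<le> ennreal l" by (rule ennreal_leI)
    then show ?thesis by (rule order_trans) simp
  qed
  interpret pair_sigma_finite M lborel ..
  have "(\<integral>\<^sup>+\<omega>. ennreal (l / max q (U \<omega>)) \<partial>M) \<le>
     (\<integral>\<^sup>+\<omega>. ennreal l + (\<integral>\<^sup>+v. ennreal (h v) * indicator {U \<omega>..} v \<partial>lborel) \<partial>M)"
    by (intro nn_integral_mono point)
  also have "\<dots> = (\<integral>\<^sup>+\<omega>. ennreal l + (\<integral>\<^sup>+v. (if U \<omega> \<le> v then ennreal (h v) else 0) \<partial>lborel) \<partial>M)"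
    by (intro nn_integral_cong arg_cong2[where f = "(+)"]) (auto simp: indicator_def)
  also have "\<dots> = ennreal l + (\<integral>\<^sup>+\<omega>. (\<integral>\<^sup>+v. (if U \<omega> \<le> v then ennreal (h v) else 0) \<partial>lborel) \<partial>M)"
    by (subst nn_integral_add) (auto simp: emeasure_space_1)
  \<comment> \<open>After the exchange the inner integral is \<open>h v\<close> times the
    probability of \<open>U \<le> v\<close>, which is at most \<open>v\<close>. The integrand
    becomes l/v on \<open>{q..1}\<close>, with integral -l ln q.\<close>
  also have "(\<integral>\<^sup>+\<omega>. (\<integral>\<^sup>+v. (if U \<omega> \<le> v then ennreal (h v) else 0) \<partial>lborel) \<partial>M) =
      (\<integral>\<^sup>+v. (\<integral>\<^sup>+\<omega>. (if U \<omega> \<le> v then ennreal (h v) else 0) \<partial>M) \<partial>lborel)"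
    by (rule Fubini'[symmetric]) measurable
  also have "\<dots> \<le> (\<integral>\<^sup>+v. ennreal (l / v) * indicator {q..1} v \<partial>lborel)"
  proof (rule nn_integral_mono)
    fix v :: real
    have "(\<integral>\<^sup>+\<omega>. (if U \<omega> \<le> v then ennreal (h v) else 0) \<partial>M) =
          (\<integral>\<^sup>+\<omega>. ennreal (h v) * indicator {\<omega> \<in> space M. U \<omega> \<le> v} \<omega> \<partial>M)"
      by (intro nn_integral_cong) (auto simp: indicator_def)
    also have "\<dots> = ennreal (h v) * emeasure M {\<omega> \<in> space M. U \<omega> \<le> v}"
      by (subst nn_integral_cmult_indicator) auto
    also have "\<dots> = ennreal (h v * prob {\<omega> \<in> space M. U \<omega> \<le> v})"
      using h0 by (simp add: emeasure_eq_measure ennreal_mult)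
    also have "\<dots> \<le> ennreal (l / v) * indicator {q..1} v"
    proof (cases "v \<in> {q..1}")
      case True
      then have "h v * prob {\<omega> \<in> space M. U \<omega> \<le> v} \<le> h v * v"
        using valid[of v] q h0 by (intro mult_left_mono) auto
      also have "\<dots> = l / v" using True q by (simp add: h_def power2_eq_square)
      finally show ?thesis using True by (simp add: ennreal_leI)
    qed (simp add: h_def)
    finally show "(\<integral>\<^sup>+\<omega>. (if U \<omega> \<le> v then ennreal (h v) else 0) \<partial>M) \<le> ennreal (l / v) * indicator {q..1} v" .
  qed
  also have "(\<integral>\<^sup>+v. ennreal (l / v) * indicator {q..1} v \<partial>lborel) = ennreal (l * ln 1 - l * ln q)"
  proof (rule nn_integral_FTC_Icc[where F = "\<lambda>x. l * ln x"])
    show "((\<lambda>x. l * ln x) has_real_derivative l / x) (at x)" if "x \<in> {q..1}" for x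
      using that q by (auto intro!: derivative_eq_intros)
  qed (use q \<open>0 < l\<close> in auto)
  also have "ennreal l + ennreal (l * ln 1 - l * ln q) = ennreal (l * (1 - ln q))"
    using q \<open>0 < l\<close> by (subst ennreal_plus[symmetric]) (auto simp: mult_le_0_iff algebra_simps)
  finally have "(\<integral>\<^sup>+\<omega>. ennreal (l / max q (U \<omega>)) \<partial>M) \<le> ennreal (l * (1 - ln q))"
    by (simp add: add_left_mono)
  moreover have "0 \<le> l * (1 - ln q)"
    by (rule mult_nonneg_nonneg) (use q \<open>0 < l\<close> ln_le_minus_one[of q] in linarith)+
  ultimately show ?thesis by (intro integral_real_bounded)
qed

end

section \<open>Measurability of the procedures\<close>

text \<open>A finite power set is countable, so the preimages of single sets suffice, and these are
  finite Boolean combinations of membership events. It serves for Su with hypotheses as elements and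
  for Su+ with sets of hypotheses as elements.\<close>

lemma measurable_random_set:
  assumes "finite A" and sub: "\<And>\<omega>. \<omega> \<in> space M \<Longrightarrow> f \<omega> \<subseteq> A"
    and mem: "\<And>a. a \<in> A \<Longrightarrow> {\<omega> \<in> space M. a \<in> f \<omega>} \<in> sets M"
  shows "f \<in> M \<rightarrow>\<^sub>M count_space (Pow A)"
proof -
  have "f -` {B} \<inter> space M \<in> sets M" if "B \<subseteq> A" for B
  proof -
    have [measurable]: "Measurable.pred M (\<lambda>\<omega>. a \<in> f \<omega>)" if "a \<in> A" for a
      using mem[OF that] by (simp add: pred_def)
    have "f -` {B} \<inter> space M = {\<omega> \<in> space M. \<forall>a\<in>A. a \<in> f \<omega> \<longleftrightarrow> a \<in> B}"
      using sub that by blast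
    also have "\<dots> \<in> sets M" using \<open>finite A\<close> by measurable
    finally show ?thesis .
  qed
  then show ?thesis
    using assms(1) sub by (subst measurable_count_space_eq2) auto
qed

lemma borel_measurable_order_stat:
  assumes "finite S" "i \<in> {1..card S}"
    and [measurable]: "\<And>j. j \<in> S \<Longrightarrow> (\<lambda>\<omega>. X \<omega> j) \<in> borel_measurable M"
  shows "(\<lambda>\<omega>. order_stat (X \<omega>) S i) \<in> borel_measurable M"
proof (unfold borel_measurable_iff_le, intro allI)
  fix c
  have "real (card {j \<in> S. X \<omega> j \<le> c}) = (\<Sum>j\<in>S. if X \<omega> j \<le> c then 1 else 0)" for \<omega>
    using assms(1) by (simp add: sum.If_cases Int_def)
  then have "{\<omega> \<in> space M. order_stat (X \<omega>) S i \<le> c} =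
     {\<omega> \<in> space M. real i \<le> (\<Sum>j\<in>S. if X \<omega> j \<le> c then 1 else 0)}"
    unfolding order_stat_le_iff[OF assms(1,2)] by (simp flip: of_nat_le_iff[where 'a = real])
  also have "\<dots> \<in> sets M" by measurable
  finally show "{\<omega> \<in> space M. order_stat (X \<omega>) S i \<le> c} \<in> sets M" .
qed

lemma borel_measurable_simes_p:
  assumes "finite S"
    and "\<And>j. j \<in> S \<Longrightarrow> (\<lambda>\<omega>. X \<omega> j) \<in> borel_measurable M"
  shows "(\<lambda>\<omega>. simes_p (X \<omega>) S) \<in> borel_measurable M"
proof -
  note [measurable] = borel_measurable_order_stat[OF assms(1) _ assms(2)]
  show ?thesis unfolding simes_p_def by measurable
qed

lemma borel_measurable_su_e:
  assumes "finite S"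
    and "\<And>j. j \<in> S \<Longrightarrow> (\<lambda>\<omega>. X \<omega> j) \<in> borel_measurable M"
  shows "(\<lambda>\<omega>. su_e \<alpha> (X \<omega>) S) \<in> borel_measurable M"
proof -
  note [measurable] = borel_measurable_simes_p[OF assms]
  show ?thesis unfolding su_e_def by measurable
qed

lemma measurable_su_set:
  assumes "\<And>j. j \<in> {1..m} \<Longrightarrow> (\<lambda>\<omega>. X \<omega> j) \<in> borel_measurable M"
  shows "(\<lambda>\<omega>. su_set m \<alpha> (X \<omega>)) \<in> M \<rightarrow>\<^sub>M count_space (Pow {1..m})"
proof (rule measurable_random_set)
  fix i assume i: "i \<in> {1..m}"
  show "{\<omega> \<in> space M. i \<in> su_set m \<alpha> (X \<omega>)} \<in> sets M"
    unfolding su_set_iff[OF i]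
  proof (rule sets.sets_Collect_finite_Ex)
    fix r assume "r \<in> {1..m}"
    then have [measurable]: "(\<lambda>\<omega>. order_stat (X \<omega>) {1..m} r) \<in> borel_measurable M"
      using assms by (intro borel_measurable_order_stat) auto
    note [measurable] = assms[OF i]
    show "{\<omega> \<in> space M. real m * order_stat (X \<omega>) {1..m} r \<le> real r * \<alpha> * l_const \<alpha>
        \<and> X \<omega> i \<le> order_stat (X \<omega>) {1..m} r} \<in> sets M"
      by measurable
  qed simp
qed (use su_set_subset in auto)

lemma measurable_su_plus:
  assumes "\<And>j. j \<in> {1..m} \<Longrightarrow> (\<lambda>\<omega>. X \<omega> j) \<in> borel_measurable M"
  shows "(\<lambda>\<omega>. su_plus m \<alpha> (X \<omega>)) \<in> M \<rightarrow>\<^sub>M count_space (Pow (Pow {1..m}))"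
proof (rule measurable_random_set)
  fix R :: "nat set" assume "R \<in> Pow {1..m}"
  then have "{\<omega> \<in> space M. R \<in> su_plus m \<alpha> (X \<omega>)} = {\<omega> \<in> space M. \<forall>S \<in> Pow {1..m} - {{}}.
        \<alpha> * su_e \<alpha> (X \<omega>) S \<ge> real (card (R \<inter> S)) / real (max (card R) 1)}"
    by (auto simp: su_plus_def)
  also have "\<dots> \<in> sets M"
  proof (rule sets.sets_Collect_finite_All)
    fix S assume "S \<in> Pow {1..m} - {{}}"
    then have [measurable]: "(\<lambda>\<omega>. su_e \<alpha> (X \<omega>) S) \<in> borel_measurable M"
      using assms finite_subset[of S "{1..m}"] by (intro borel_measurable_su_e) auto
    show "{\<omega> \<in> space M. \<alpha> * su_e \<alpha> (X \<omega>) S \<ge> real (card (R \<inter> S)) / real (max (card R) 1)} \<in> sets M"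
      by measurable
  qed simp
  finally show "{\<omega> \<in> space M. R \<in> su_plus m \<alpha> (X \<omega>)} \<in> sets M" .
qed (auto simp: su_plus_def)

section \<open>FDR control through the e-value of the true hypotheses\<close>

text \<open>Raising p-values can only lower the counts. This makes the events \<open>D k\<close> in
  the proof of \<open>simes_inequality\<close> instances of PRDN.\<close>

lemma increasing_low_counts:
  fixes I :: "nat set" and k n :: nat and c :: real
  assumes "finite I"
  defines "A \<equiv> {x \<in> \<Pi>\<^sub>E i\<in>I. UNIV. \<forall>j\<in>{k<..n}. card {i \<in> I. x i \<le> c * real j} < j}"
  shows "increasing_set I A" "A \<in> sets (\<Pi>\<^sub>M i\<in>I. borel)"
proof -
  show "increasing_set I A"
    unfolding increasing_set_def
  proof (intro conjI ballI impI)
    fix x y :: "nat \<Rightarrow> real"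
    assume x: "x \<in> A" and y: "y \<in> (\<Pi>\<^sub>E i\<in>I. UNIV)" and le: "\<forall>i\<in>I. x i \<le> y i"
    have "card {i \<in> I. y i \<le> c * real j} < j" if "j \<in> {k<..n}" for j
    proof -
      have "card {i \<in> I. y i \<le> c * real j} \<le> card {i \<in> I. x i \<le> c * real j}"
        using assms(1) le by (intro card_mono) (auto intro: order_trans)
      also have "\<dots> < j" using x that by (simp add: A_def)
      finally show ?thesis .
    qed
    then show "y \<in> A" using y by (simp add: A_def)
  qed (auto simp: A_def)
  have card_eq: "real (card {i \<in> I. x i \<le> c * real j}) = (\<Sum>i\<in>I. if x i \<le> c * real j then 1 else 0)" for x j
    using assms(1) by (simp add: sum.If_cases Int_def)
  have "card {i \<in> I. x i \<le> c * real j} < j \<longleftrightarrow>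
      (\<Sum>i\<in>I. if x i \<le> c * real j then 1 else 0) < real j" for x j
    unfolding card_eq[symmetric] by simp
  then have "A = {x \<in> space (\<Pi>\<^sub>M i\<in>I. borel). \<forall>j\<in>{k<..n}. (\<Sum>i\<in>I. if x i \<le> c * real j then 1 else 0) < real j}"
    by (simp only: A_def space_PiM space_borel)
  also have "\<dots> \<in> sets (\<Pi>\<^sub>M i\<in>I. borel)" by measurable
  finally show "A \<in> sets (\<Pi>\<^sub>M i\<in>I. borel)" .
qed

lemma fdp_nonneg: "0 \<le> fdp R T"
  by (simp add: fdp_def)

text \<open>As \<open>N\<close> is nonempty, it is one of the sets \<open>S\<close> in the
  definition of \<open>su_plus\<close>, and its constraint is the claimed bound. The inserted 0 is
  covered by nonnegativity of the e-value.\<close>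

lemma Max_fdp_le_su_e:
  assumes "0 < \<alpha>" "\<alpha> \<le> 1" "N \<subseteq> {1..m}" "N \<noteq> {}" "\<And>i. i \<in> {1..m} \<Longrightarrow> 0 \<le> x i"
  shows "Max (insert 0 ((\<lambda>R. fdp R N) ` su_plus m \<alpha> x)) \<le> \<alpha> * su_e \<alpha> x N"
proof -
  have "finite (su_plus m \<alpha> x)"
    by (rule finite_subset[of _ "Pow {1..m}"]) (auto simp: su_plus_def)
  moreover have "0 \<le> simes_p x N"
    using assms finite_subset[of N "{1..m}"] by (intro simes_p_nonneg) auto
  ultimately show ?thesis
    using su_e_bounds(1)[OF assms(1,2)] assms(3,4)
    by (subst Max_le_iff) (auto simp: su_plus_def fdp_def)
qed

text \<open>Truncating the e-value at 1/\<alpha> = l/q is the same as truncating the Simes p-value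
  below at q. This also absorbs the convention for Simes p-value 0 and gives the form of
  \<open>expectation_truncated_inverse_le\<close>.\<close>

lemma truncated_su_e:
  assumes "0 < \<alpha>" "\<alpha> \<le> 1" "0 \<le> simes_p x S"
  shows "su_e \<alpha> x S = l_const \<alpha> / max (\<alpha> * l_const \<alpha>) (simes_p x S)"
proof (cases "simes_p x S = 0")
  case True
  then show ?thesis using assms l_const_pos[OF assms(1,2)] by (simp add: su_e_def)
next
  case False
  then have "0 < simes_p x S" using assms(3) by simp
  then show ?thesis
    using assms l_const_pos[OF assms(1,2)] by (simp add: su_e_def min_def max_def field_simps)
qed

text \<open>The Simes inequality provides the distributional bound needed in
  \<open>expectation_truncated_inverse_le\<close>, and \<open>l_const_ln\<close> evaluates the
  resulting bound to 1.\<close>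

lemma (in prob_space) expectation_su_e_le_1:
  fixes X :: "'a \<Rightarrow> nat \<Rightarrow> real"
  assumes \<alpha>: "0 < \<alpha>" "\<alpha> \<le> 1" and N: "finite N" "N \<noteq> {}"
    and X: "\<And>i. i \<in> N \<Longrightarrow> (\<lambda>\<omega>. X \<omega> i) \<in> borel_measurable M"
    and nonneg: "\<And>\<omega> i. \<omega> \<in> space M \<Longrightarrow> i \<in> N \<Longrightarrow> 0 \<le> X \<omega> i"
    and valid: "\<And>i t. i \<in> N \<Longrightarrow> 0 \<le> t \<Longrightarrow> t \<le> 1 \<Longrightarrow> prob {\<omega> \<in> space M. X \<omega> i \<le> t} \<le> t"
    and dep: "\<And>A i. A \<in> sets (\<Pi>\<^sub>M j\<in>N. borel) \<Longrightarrow> i \<in> N \<Longrightarrow> increasing_set N A \<Longrightarrow>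
        \<exists>g::real \<Rightarrow> real. mono g \<and> (AE \<omega> in M. real_cond_exp M (vimage_algebra (space M) (\<lambda>\<omega>. X \<omega> i) borel)
               (indicator {\<omega> \<in> space M. restrict (X \<omega>) N \<in> A}) \<omega> = g (X \<omega> i))"
  shows "(\<integral>\<omega>. su_e \<alpha> (X \<omega>) N \<partial>M) \<le> 1"
proof -
  have simes: "prob {\<omega> \<in> space M. simes_p (X \<omega>) N \<le> v} \<le> v" if v: "0 \<le> v" "v \<le> 1" for v
    unfolding simes_p_le_iff[OF N]
  proof (rule simes_inequality[where X = "\<lambda>i \<omega>. X \<omega> i", OF N v X valid])
    fix i k s t assume i: "i \<in> N" and "(s::real) \<le> t"
    \<comment> \<open>Pulled back along the p-values, \<open>A\<close> becomes the event in the
      dependence assumption of \<open>simes_inequality\<close>.\<close>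
    define A where "A = {x \<in> \<Pi>\<^sub>E i\<in>N. UNIV. \<forall>j\<in>{k<..card N}. card {i \<in> N. x i \<le> v / card N * real j} < j}"
    have A: "increasing_set N A" "A \<in> sets (\<Pi>\<^sub>M j\<in>N. borel)"
      unfolding A_def using increasing_low_counts[OF N(1)] by blast+
    define B where "B = {\<omega> \<in> space M. restrict (X \<omega>) N \<in> A}"
    have "(\<lambda>\<omega>. restrict (X \<omega>) N) \<in> M \<rightarrow>\<^sub>M (\<Pi>\<^sub>M j\<in>N. borel)"
      using X by (intro measurable_restrict) auto
    then have B: "B \<in> sets M"
      unfolding B_def using A(2) measurable_sets by (auto simp: vimage_def Int_def conj_commute)
    have "{i \<in> N. restrict (X \<omega>) N i \<le> r} = {i \<in> N. X \<omega> i \<le> r}" for \<omega> r by auto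
    then have "{\<omega> \<in> space M. \<forall>j\<in>{k<..card N}. card {i \<in> N. X \<omega> i \<le> v / card N * real j} < j} = B"
      unfolding B_def A_def by (auto simp del: restrict_apply)
    moreover obtain g :: "real \<Rightarrow> real" where "mono g"
      "AE \<omega> in M. real_cond_exp M (vimage_algebra (space M) (\<lambda>\<omega>. X \<omega> i) borel) (indicator B) \<omega> = g (X \<omega> i)"
      using dep[OF A(2) i A(1)] unfolding B_def by blast
    ultimately show "let B = {\<omega> \<in> space M. \<forall>j\<in>{k<..card N}. card {i \<in> N. X \<omega> i \<le> v / card N * real j} < j} in
       prob ({\<omega> \<in> space M. X \<omega> i \<le> s} \<inter> B) * prob {\<omega> \<in> space M. X \<omega> i \<le> t}
       \<le> prob ({\<omega> \<in> space M. X \<omega> i \<le> t} \<inter> B) * prob {\<omega> \<in> space M. X \<omega> i \<le> s}"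
      unfolding Let_def using mono_cond_prob_ratio[OF X[OF i] B _ _ \<open>s \<le> t\<close>] by simp
  qed
  have pos: "0 \<le> simes_p (X \<omega>) N" if "\<omega> \<in> space M" for \<omega>
    using N nonneg that by (intro simes_p_nonneg) auto
  have "(\<integral>\<omega>. su_e \<alpha> (X \<omega>) N \<partial>M) = (\<integral>\<omega>. l_const \<alpha> / max (\<alpha> * l_const \<alpha>) (simes_p (X \<omega>) N) \<partial>M)"
    by (intro Bochner_Integration.integral_cong refl truncated_su_e[OF \<alpha> pos])
  also have "\<dots> \<le> l_const \<alpha> * (1 - ln (\<alpha> * l_const \<alpha>))"
    using \<alpha> l_const_pos[OF \<alpha>] level_le_1[OF \<alpha>]
    by (intro expectation_truncated_inverse_le borel_measurable_simes_p N X pos simes) auto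
  finally show ?thesis using l_const_ln[OF \<alpha>] by simp
qed

section \<open>FDR control of Su and Su+, and the uniform improvement\<close>

theorem theorem4:
  fixes \<Omega> :: "'a measure" and M :: "'a measure set" and H :: "nat \<Rightarrow> 'a measure set"
    and p :: "'a \<Rightarrow> nat \<Rightarrow> real" and V :: "real set" and m :: nat and \<alpha> :: real
  assumes "m > 1"
    and "0 < \<alpha>" and "\<alpha> \<le> 1"
    and "V = {0..} \<or> (V = {0..1} \<and> \<alpha> < 1)"
    and "statistical_model \<Omega> M"
    and "\<And>i. i \<in> {1..m} \<Longrightarrow> H i \<subseteq> M"
    and "p \<in> \<Omega> \<rightarrow>\<^sub>M pval_space m V"
    and "valid_pvalues M (true_hyps m H) p"
    and "PRDN M (true_hyps m H) p"
  shows "uniformly_improves m V \<Omega> M (true_hyps m H) p \<alpha> (su_plus m \<alpha>) (su_set m \<alpha>)"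
proof -
  note \<alpha> = assms(2,3)
  define q where "q = \<alpha> * l_const \<alpha>"
  have q: "0 < q" "q \<le> 1" using \<alpha> l_const_pos[OF \<alpha>] level_le_1[OF \<alpha>] by (auto simp: q_def)
  have space_V: "space (pval_space m V) = (\<Pi>\<^sub>E i\<in>{1..m}. V)"
    by (simp add: pval_space_def space_PiM space_restrict_space)
  have V0: "0 \<le> v" if "v \<in> V" for v using that assms(4) by auto
  have p_nonneg: "0 \<le> p \<omega> i" if "\<omega> \<in> space \<Omega>" "i \<in> {1..m}" for \<omega> i
    using measurable_space[OF assms(7) that(1)] that(2) V0 unfolding space_V by blast
  have p_meas: "(\<lambda>\<omega>. p \<omega> i) \<in> borel_measurable \<Omega>" if "i \<in> {1..m}" for i
  proof -
    have "(\<lambda>x. x i) \<in> pval_space m V \<rightarrow>\<^sub>M restrict_space borel V"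
      unfolding pval_space_def using that by (rule measurable_component_singleton)
    from measurable_compose[OF assms(7) this] show ?thesis
      by (rule measurable_restrict_space2_iff[THEN iffD1, THEN conjunct1])
  qed
  have in_plus: "su_set m \<alpha> x \<in> su_plus m \<alpha> x" if "\<And>i. i \<in> {1..m} \<Longrightarrow> 0 \<le> x i" for x
    using su_set_in_su_plus[OF \<alpha>] that .
  note plus_meas = measurable_su_plus[of m p, OF p_meas]
  note set_meas = measurable_su_set[of m p, OF p_meas]

  have FDR: "(\<integral>\<omega>. Max (insert 0 ((\<lambda>R. fdp R N) ` su_plus m \<alpha> (p \<omega>))) \<partial>P) \<le> \<alpha>"
    "(\<integral>\<omega>. fdp (su_set m \<alpha> (p \<omega>)) N \<partial>P) \<le> \<alpha>"
    if P: "P \<in> M" and N_def: "N = true_hyps m H P" for P N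
  proof -
    interpret prob_space P using assms(5) P by (simp add: statistical_model_def)
    have sets[measurable_cong]: "sets P = sets \<Omega>" using assms(5) P by (simp add: statistical_model_def)
    then have space: "space P = space \<Omega>" by (rule sets_eq_imp_space_eq)
    have N: "N \<subseteq> {1..m}" by (auto simp: N_def true_hyps_def)
    then have finN: "finite N" by (rule finite_subset) simp
    let ?f = "\<lambda>C. Max (insert 0 ((\<lambda>R. fdp R N) ` C))"
    \<comment> \<open>Without true hypotheses there is no e-value to compare with, but then all
      false discovery proportions are 0.\<close>
    have le: "?f (su_plus m \<alpha> (p \<omega>)) \<le> (if N = {} then 0 else \<alpha> * su_e \<alpha> (p \<omega>) N)" if "\<omega> \<in> space P" for \<omega>
    proof (cases "N = {}")
      case True
      then show ?thesis by (auto simp: fdp_def image_constant_conv)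
    next
      case False
      then show ?thesis using Max_fdp_le_su_e[OF \<alpha> N False] p_nonneg that space by auto
    qed
    \<comment> \<open>The Su set is a member of Su+, so FDR control of Su is inherited from
      Su+.\<close>
    have fdp_le: "fdp (su_set m \<alpha> (p \<omega>)) N \<le> ?f (su_plus m \<alpha> (p \<omega>))" if "\<omega> \<in> space P" for \<omega>
    proof -
      have "finite (su_plus m \<alpha> (p \<omega>))"
        by (rule finite_subset[of _ "Pow {1..m}"]) (auto simp: su_plus_def)
      then show ?thesis using in_plus p_nonneg that space by (intro Max_ge) auto
    qed
    have e_bounds: "0 \<le> \<alpha> * su_e \<alpha> (p \<omega>) N" "\<alpha> * su_e \<alpha> (p \<omega>) N \<le> 1" if "\<omega> \<in> space P" "N \<noteq> {}" for \<omega>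
    proof -
      have "0 \<le> simes_p (p \<omega>) N"
        using that p_nonneg N finN space by (intro simes_p_nonneg) auto
      then show "0 \<le> \<alpha> * su_e \<alpha> (p \<omega>) N" "\<alpha> * su_e \<alpha> (p \<omega>) N \<le> 1"
        by (rule su_e_bounds[OF \<alpha>])+
    qed
    have e_meas: "(\<lambda>\<omega>. su_e \<alpha> (p \<omega>) N) \<in> borel_measurable P"
      using borel_measurable_su_e[OF finN, of p \<Omega>] p_meas N by (simp add: measurable_cong_sets[OF sets refl] subset_iff)
    have int_e: "integrable P (\<lambda>\<omega>. if N = {} then 0 else \<alpha> * su_e \<alpha> (p \<omega>) N)"
      by (rule integrable_const_bound[of _ 1]) (use e_bounds e_meas in auto)
    have f_bounds: "0 \<le> ?f (su_plus m \<alpha> (p \<omega>))" "?f (su_plus m \<alpha> (p \<omega>)) \<le> 1" if "\<omega> \<in> space P" for \<omega>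
      using order_trans[OF fdp_nonneg fdp_le[OF that]] order_trans[OF le[OF that], of 1] e_bounds(2)[OF that]
      by auto
    have int_f: "integrable P (\<lambda>\<omega>. ?f (su_plus m \<alpha> (p \<omega>)))"
    proof (rule integrable_const_bound[of _ 1])
      show "(\<lambda>\<omega>. ?f (su_plus m \<alpha> (p \<omega>))) \<in> borel_measurable P"
        unfolding measurable_cong_sets[OF sets refl]
        by (rule measurable_compose[OF plus_meas]) (auto simp only: measurable_count_space_eq1 space_borel)
    qed (use f_bounds in auto)
    have int_s: "integrable P (\<lambda>\<omega>. fdp (su_set m \<alpha> (p \<omega>)) N)"
    proof (rule integrable_const_bound[of _ 1])
      show "(\<lambda>\<omega>. fdp (su_set m \<alpha> (p \<omega>)) N) \<in> borel_measurable P"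
        unfolding measurable_cong_sets[OF sets refl]
        by (rule measurable_compose[OF set_meas]) (auto simp only: measurable_count_space_eq1 space_borel)
    qed (use order_trans[OF fdp_le f_bounds(2)] fdp_nonneg in auto)
    have "(\<integral>\<omega>. (if N = {} then 0 else \<alpha> * su_e \<alpha> (p \<omega>) N) \<partial>P) \<le> \<alpha>"
    proof (cases "N = {}")
      case False
      have "(\<integral>\<omega>. su_e \<alpha> (p \<omega>) N \<partial>P) \<le> 1"
      proof (rule expectation_su_e_le_1[OF \<alpha> finN False])
        show "(\<lambda>\<omega>. p \<omega> i) \<in> borel_measurable P" if "i \<in> N" for i
          using that N p_meas by (auto simp: measurable_cong_sets[OF sets refl])
        show "0 \<le> p \<omega> i" if "\<omega> \<in> space P" "i \<in> N" for \<omega> i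
          using that N p_nonneg space by auto
        show "prob {\<omega> \<in> space P. p \<omega> i \<le> t} \<le> t" if "i \<in> N" "0 \<le> t" "t \<le> 1" for i t
          using assms(8) P that by (simp add: valid_pvalues_def N_def)
      qed (use assms(9) P in \<open>simp add: PRDN_def N_def\<close>)
      then show ?thesis using False \<alpha> by (simp add: mult_left_le)
    qed (use \<alpha> in simp)
    moreover have "(\<integral>\<omega>. ?f (su_plus m \<alpha> (p \<omega>)) \<partial>P) \<le> (\<integral>\<omega>. (if N = {} then 0 else \<alpha> * su_e \<alpha> (p \<omega>) N) \<partial>P)"
      by (intro integral_mono int_f int_e le)
    ultimately show "(\<integral>\<omega>. ?f (su_plus m \<alpha> (p \<omega>)) \<partial>P) \<le> \<alpha>" by linarith
    moreover have "(\<integral>\<omega>. fdp (su_set m \<alpha> (p \<omega>)) N \<partial>P) \<le> (\<integral>\<omega>. ?f (su_plus m \<alpha> (p \<omega>)) \<partial>P)"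
      by (intro integral_mono int_s int_f fdp_le)
    ultimately show "(\<integral>\<omega>. fdp (su_set m \<alpha> (p \<omega>)) N \<partial>P) \<le> \<alpha>" by linarith
  qed

  have "\<exists>E\<in>sets (pval_space m V). E \<noteq> {} \<and> (\<forall>x\<in>E. \<exists>R. su_set m \<alpha> x \<subset> R \<and> R \<in> su_plus m \<alpha> x)"
  proof -
    \<comment> \<open>The bound 1 in \<open>V = {0..1}\<close> still leaves room above
      \<open>q\<close>, because \<alpha> < 1 gives \<open>q < 1\<close>.\<close>
    obtain y where y: "q < y" "y \<le> 2 * q" "y \<in> V"
    proof (cases "V = {0..}")
      case True
      then show thesis using q by (intro that[of "2 * q"]) auto
    next
      case False
      then have "V = {0..1}" "q < 1" using assms(4) level_less_1[OF \<alpha>] by (auto simp: q_def)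
      then show thesis using q by (intro that[of "min 1 (2 * q)"]) auto
    qed
    define x where "x = (\<lambda>i\<in>{1..m}. if i = m then y else 0)"
    \<comment> \<open>The event consists of one vector of p-values; written as a finite product of
      singletons it is measurable.\<close>
    have "{x} = (\<Pi>\<^sub>E i\<in>{1..m}. {x i})"
      by (auto simp: x_def PiE_iff extensional_def fun_eq_iff)
    also have "\<dots> \<in> sets (pval_space m V)"
      unfolding pval_space_def
    proof (rule sets_PiM_I_finite)
      fix i assume "i \<in> {1..m}"
      then have "x i \<in> V" using y(3) assms(4) by (auto simp: x_def)
      then show "{x i} \<in> sets (restrict_space borel V)"
        using assms(4) by (subst sets_restrict_space_iff) auto
    qed simp
    finally have "{x} \<in> sets (pval_space m V)" .
    moreover have "su_set m \<alpha> x \<subset> {1..m}" "{1..m} \<in> su_plus m \<alpha> x"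
      using assms(1) y(1,2) by (intro su_plus_strict[OF _ \<alpha>, of m y]; auto simp: x_def q_def)+
    ultimately show ?thesis by blast
  qed
  moreover have "\<forall>x\<in>space (pval_space m V). su_set m \<alpha> x \<in> su_plus m \<alpha> x"
  proof
    fix x assume "x \<in> space (pval_space m V)"
    then show "su_set m \<alpha> x \<in> su_plus m \<alpha> x"
      unfolding space_V by (intro in_plus V0) (rule PiE_mem)
  qed
  moreover have "controls_FDR_collection m \<Omega> M (true_hyps m H) \<alpha> (\<lambda>\<omega>. su_plus m \<alpha> (p \<omega>))"
    unfolding controls_FDR_collection_def
    by (intro conjI ballI plus_meas FDR(1)[OF _ refl])
  moreover have "controls_FDR_set m \<Omega> M (true_hyps m H) \<alpha> (\<lambda>\<omega>. su_set m \<alpha> (p \<omega>))"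
    unfolding controls_FDR_set_def
    by (intro conjI ballI set_meas FDR(2)[OF _ refl])
  ultimately show ?thesis
    unfolding uniformly_improves_def by (intro conjI)
qed

end
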